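(* The simple group $A_5$ satisfies the EKR-module property; that is, every transitive action of $A_5$ satisfies the EKR-module property.
   Context: Let $G$ be a finite group acting transitively on a set $\Omega$. Elements $\sigma,\tau\in G$ intersect if $\sigma\tau^{-1}$ fixes a point of $\Omega$; a subset of $G$ is an intersecting set if any two of its elements intersect; a maximum intersecting set is an intersecting set of maximum possible size. For $S\subseteq G$, $\mathbf{v}_S=\sum_{s\in S}s\in\mathbb{C}G$ is its characteristic vector in the group algebra. The canonical vectors are $\mathbf{v}_{\alpha,\beta}=\sum_{t\in G,\ t\cdot\alpha=\beta}t$ for $\alpha,\beta\in\Omega$. The action of $G$ on $\Omega$ satisfies the EKR-module property if the characteristic vector of each maximum intersecting set is a $\mathbb{C}$-linear combination of canonical vectors. A finite group is said to satisfy the EKR-module property if every transitive action of it satisfies the EKR-module property. $A_5$ is the alternating group of degree $5$. *)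

theory Defs
  imports
    Complex_Main
    "HOL-Library.Poly_Mapping"
    "HOL-Algebra.Group_Action"
    "HOL-Algebra.Sym_Groups"
begin

section \<open>The group algebra as a complex vector space\<close>

text \<open>
  Formal complex combinations of elements of a group \<open>G\<close> are finitely supported functions
  \<open>'g \<Rightarrow>\<^sub>0 complex\<close>, with \<open>Poly_Mapping.single s 1\<close> as the basis vector \<open>s\<close>. The type contains
  the group algebra of \<open>G\<close> as the subspace of those supported on \<open>carrier G\<close>, and every vector
  below lies in that subspace. Only the vector space structure is needed, so the product of the
  group algebra is not introduced.
\<close>

definition ga_scale :: "complex \<Rightarrow> ('g \<Rightarrow>\<^sub>0 complex) \<Rightarrow> ('g \<Rightarrow>\<^sub>0 complex)"
  where "ga_scale c v = Poly_Mapping.map (\<lambda>x. c * x) v"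

lemma lookup_ga_scale [simp]:
  "Poly_Mapping.lookup (ga_scale c v) g = c * Poly_Mapping.lookup v g"
  unfolding ga_scale_def by (simp add: Poly_Mapping.map.rep_eq when_def)

global_interpretation group_algebra: vector_space ga_scale
  by unfold_locales (auto intro!: poly_mapping_eqI simp: lookup_add algebra_simps)

definition char_vec :: "'g set \<Rightarrow> ('g \<Rightarrow>\<^sub>0 complex)"
  where "char_vec S = (\<Sum>s\<in>S. Poly_Mapping.single s 1)"

definition canonical_vec ::
  "('g, 'm) monoid_scheme \<Rightarrow> ('g \<Rightarrow> 'b \<Rightarrow> 'b) \<Rightarrow> 'b \<Rightarrow> 'b \<Rightarrow> ('g \<Rightarrow>\<^sub>0 complex)"
  where "canonical_vec G \<phi> \<alpha> \<beta> = (\<Sum>t\<in>{t \<in> carrier G. \<phi> t \<alpha> = \<beta>}. Poly_Mapping.single t 1)"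


section \<open>Intersecting sets and the EKR-module property\<close>

definition intersect ::
  "('g, 'm) monoid_scheme \<Rightarrow> 'b set \<Rightarrow> ('g \<Rightarrow> 'b \<Rightarrow> 'b) \<Rightarrow> 'g \<Rightarrow> 'g \<Rightarrow> bool"
  where "intersect G \<Omega> \<phi> \<sigma> \<tau> \<longleftrightarrow> (\<exists>\<omega>\<in>\<Omega>. \<phi> (\<sigma> \<otimes>\<^bsub>G\<^esub> inv\<^bsub>G\<^esub> \<tau>) \<omega> = \<omega>)"

definition intersecting_set ::
  "('g, 'm) monoid_scheme \<Rightarrow> 'b set \<Rightarrow> ('g \<Rightarrow> 'b \<Rightarrow> 'b) \<Rightarrow> 'g set \<Rightarrow> bool"
  where "intersecting_set G \<Omega> \<phi> S \<longleftrightarrow>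
    S \<subseteq> carrier G \<and> (\<forall>\<sigma>\<in>S. \<forall>\<tau>\<in>S. intersect G \<Omega> \<phi> \<sigma> \<tau>)"

text \<open>The use of \<open>card\<close> is meaningful because the groups considered are finite.\<close>

definition maximum_intersecting_set ::
  "('g, 'm) monoid_scheme \<Rightarrow> 'b set \<Rightarrow> ('g \<Rightarrow> 'b \<Rightarrow> 'b) \<Rightarrow> 'g set \<Rightarrow> bool"
  where "maximum_intersecting_set G \<Omega> \<phi> S \<longleftrightarrow>
    intersecting_set G \<Omega> \<phi> S \<and> (\<forall>T. intersecting_set G \<Omega> \<phi> T \<longrightarrow> card T \<le> card S)"

definition action_EKR_module_property ::
  "('g, 'm) monoid_scheme \<Rightarrow> 'b set \<Rightarrow> ('g \<Rightarrow> 'b \<Rightarrow> 'b) \<Rightarrow> bool"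
  where "action_EKR_module_property G \<Omega> \<phi> \<longleftrightarrow>
    (\<forall>S. maximum_intersecting_set G \<Omega> \<phi> S \<longrightarrow>
      char_vec S \<in> group_algebra.span {canonical_vec G \<phi> \<alpha> \<beta> | \<alpha> \<beta>. \<alpha> \<in> \<Omega> \<and> \<beta> \<in> \<Omega>})"

text \<open>
  HOL cannot quantify over types inside a formula, so the type \<open>'b\<close> of the points is a
  parameter. A theorem about \<open>TYPE('b)\<close> with \<open>'b\<close> a type variable speaks about
  all transitive actions, on sets of any type.
\<close>

definition group_EKR_module_property :: "'b itself \<Rightarrow> ('g, 'm) monoid_scheme \<Rightarrow> bool"
  where "group_EKR_module_property (_ :: 'b itself) G \<longleftrightarrow>
    group G \<and> finite (carrier G) \<and>
    (\<forall>(\<Omega> :: 'b set) \<phi>. transitive_action G \<Omega> \<phi> \<longrightarrow> action_EKR_module_property G \<Omega> \<phi>)"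

end

theory Submission
  imports Defs
begin

text \<open>Let \<open>S\<close> be a maximum intersecting set of a transitive action and \<open>f\<close> its indicator function.
The canonical vectors span a two-sided ideal of the group algebra, so they contain the whole
block of an irreducible character, or nothing of it. The proof works with rational characters only:
\<open>1\<close>, the sum \<open>\<rho>\<close> of the two characters of degree \<open>3\<close>, and the characters \<open>\<chi>\<^sub>4\<close> and \<open>\<chi>\<^sub>5\<close> of degrees
\<open>4\<close> and \<open>5\<close>. On \<open>A\<^sub>5\<close> they depend only on the number of points of \<open>{1..5}\<close> that an element fixes:
\<open>5\<close> for the identity, \<open>1\<close> for the \<open>15\<close> involutions, \<open>2\<close> for the \<open>20\<close> three-cycles and \<open>0\<close> for the
\<open>24\<close> five-cycles. The same is true of the permutation character of the action, whose values on
these four classes are written \<open>n\<close>, \<open>a\<close>, \<open>b\<close>, \<open>c\<close> here; \<open>n\<close> is the number of points and Burnside's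
lemma gives \<open>n + 15a + 20b + 24c = 60\<close>.

Convolving any function with the permutation character gives a combination of canonical vectors
(lemma \<open>perm_char_sum_in_canonical_span\<close>). On the blocks of \<open>\<rho>\<close>, \<open>\<chi>\<^sub>4\<close>, \<open>\<chi>\<^sub>5\<close> this convolution is
multiplication by \<open>n - 5a + 4c\<close>, \<open>n + 5b - 6c\<close>, \<open>n + 3a - 4b\<close>, the coefficients being the central character values.
Hence \<open>f\<close> lies in the span as soon as its part in every block with eigenvalue zero vanishes
(lemma \<open>fun_vec_in_canonical_span\<close>).

The required vanishing is the equality case of a ratio bound. Up to a positive factor, the squared
norm of the part of \<open>f\<close> in the block of \<open>\<chi>\<close> is the sum of \<open>\<chi>(x\<inverse>y)\<close> over \<open>x, y \<in> S\<close>, hence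
nonnegative. Only classes with fixed points on \<open>\<Omega>\<close> occur among the quotients. If the
only such nontrivial class is that of the involutions, the sum for \<open>\<rho>\<close> is \<open>s (8 - 2s)\<close> with
\<open>s = |S|\<close>, so \<open>s \<le> 4\<close>; but a Klein four-group is intersecting, so \<open>s = 4\<close> and the \<open>\<rho>\<close>-part is zero.
In the same way five-cycles alone are handled by \<open>\<chi>\<^sub>4\<close> and a cyclic group of order \<open>5\<close>, involutions
and three-cycles by \<open>\<rho>\<close> and \<open>\<chi>\<^sub>5\<close> and a subgroup \<open>A\<^sub>4\<close>, involutions and five-cycles by \<open>\<rho>\<close> and \<open>\<chi>\<^sub>4\<close>
and a dihedral group of order \<open>10\<close>. In each of these cases the remaining eigenvalues are positive.
If involutions have no fixed point and three-cycles have one, all eigenvalues are nonzero by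
arithmetic in Burnside's equation. If no nontrivial element has a fixed point, all three
eigenvalues are equal to \<open>n\<close>; if every element has one, \<open>S\<close> is the whole group. Neither the
subgroups of \<open>A\<^sub>5\<close> nor the maximum intersecting sets have to be classified.

The facts about \<open>A\<^sub>5\<close> itself that enter (the class algebra, conjugacy of elements of the same class,
and the four subgroups) are finite checks on the \<open>60\<close> even permutations written as lists.\<close>

section \<open>Even permutations of five points in one-line notation\<close>

abbreviation A5 :: "(nat \<Rightarrow> nat) monoid" where "A5 \<equiv> alt_group 5"
abbreviation GA :: "(nat \<Rightarrow> nat) set" where "GA \<equiv> carrier A5"

definition nfix :: "(nat \<Rightarrow> nat) \<Rightarrow> nat" where
  "nfix p = card {i \<in> {1..5}. p i = i}"

text \<open>A list \<open>xs\<close> of length five is the one-line notation of a permutation, with the points and the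
entries shifted to start from \<open>0\<close> so that composition is list indexing.\<close>

definition perm_of :: "nat list \<Rightarrow> nat \<Rightarrow> nat" where
  "perm_of xs i = (if i \<in> {1..5} then Suc (xs ! (i - 1)) else i)"

definition word_comp :: "nat list \<Rightarrow> nat list \<Rightarrow> nat list" where
  "word_comp xs ys = map (\<lambda>i. xs ! i) ys"

definition word_fix :: "nat list \<Rightarrow> nat" where
  "word_fix xs = length (filter (\<lambda>i. xs ! i = i) [0, 1, 2, 3, 4])"

definition is_word :: "nat list \<Rightarrow> bool" where
  "is_word xs \<longleftrightarrow> length xs = 5 \<and> list_all (\<lambda>i. i < 5) xs"

definition V4_words :: "nat list list" where
  "V4_words = [[0,1,2,3,4], [1,0,3,2,4], [2,3,0,1,4], [3,2,1,0,4]]"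
definition C3_words :: "nat list list" where
  "C3_words = [[0,1,2,3,4], [1,2,0,3,4], [2,0,1,3,4]]"
definition C5_words :: "nat list list" where
  "C5_words = [[0,1,2,3,4], [1,2,3,4,0], [2,3,4,0,1], [3,4,0,1,2], [4,0,1,2,3]]"
definition A4_words :: "nat list list" where
  "A4_words = [word_comp v t. v \<leftarrow> V4_words, t \<leftarrow> C3_words]"
definition D5_words :: "nat list list" where
  "D5_words = [word_comp r c. r \<leftarrow> [[0,1,2,3,4], [0,4,3,2,1]], c \<leftarrow> C5_words]"

text \<open>The factorisation \<open>A\<^sub>5 = V\<^sub>4 C\<^sub>3 C\<^sub>5\<close> lists every element once, and makes evenness of the listed
permutations a matter of a few generators.\<close>

definition A5_words :: "nat list list" where
  "A5_words = [word_comp a c. a \<leftarrow> A4_words, c \<leftarrow> C5_words]"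

definition class_words :: "nat \<Rightarrow> nat list list" where
  "class_words k = filter (\<lambda>c. word_fix c = k) A5_words"

lemma is_word_comp: "is_word xs \<Longrightarrow> is_word ys \<Longrightarrow> is_word (word_comp xs ys)"
  by (auto simp: is_word_def word_comp_def list_all_iff)

lemma perm_of_comp: "is_word ys \<Longrightarrow> perm_of (word_comp xs ys) = perm_of xs \<circ> perm_of ys"
proof
  assume w: "is_word ys"
  fix i
  show "perm_of (word_comp xs ys) i = (perm_of xs \<circ> perm_of ys) i"
  proof (cases "i \<in> {1..5}")
    case True
    then have "i - 1 < length ys" using w by (auto simp: is_word_def)
    then have "ys ! (i - 1) < 5" using w by (auto simp: is_word_def list_all_length)
    then show ?thesis using True \<open>i - 1 < length ys\<close> by (simp add: perm_of_def word_comp_def)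
  next
    case False
    then have "perm_of zs i = i" for zs unfolding perm_of_def by (rule if_not_P)
    then show ?thesis by simp
  qed
qed

lemma nfix_perm_of: "nfix (perm_of xs) = word_fix xs"
proof -
  have points: "set [0, 1, 2, 3, 4] = {..<5::nat}" by auto
  have "{i \<in> {1..5}. perm_of xs i = i} = Suc ` set (filter (\<lambda>i. xs ! i = i) [0, 1, 2, 3, 4])"
    (is "?A = Suc ` ?B")
  proof (intro equalityI subsetI)
    fix i assume "i \<in> ?A"
    then have "i - 1 \<in> ?B" "i = Suc (i - 1)"
      unfolding set_filter points by (auto simp: perm_of_def)
    then show "i \<in> Suc ` ?B" by blast
  next
    fix i assume "i \<in> Suc ` ?B"
    then show "i \<in> ?A" unfolding set_filter points by (auto simp: perm_of_def)
  qed
  moreover have "card ?B = word_fix xs"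
    unfolding word_fix_def by (intro distinct_card distinct_filter) simp
  ultimately show ?thesis unfolding nfix_def by (simp add: card_image)
qed

lemma perm_of_inject: "is_word xs \<Longrightarrow> is_word ys \<Longrightarrow> perm_of xs = perm_of ys \<Longrightarrow> xs = ys"
proof (rule nth_equalityI)
  assume w: "is_word xs" "is_word ys" and eq: "perm_of xs = perm_of ys"
  then show "length xs = length ys" by (simp add: is_word_def)
  fix i assume "i < length xs"
  then have "i < 5" using w by (simp add: is_word_def)
  then show "xs ! i = ys ! i" using fun_cong[OF eq, of "Suc i"] by (simp add: perm_of_def)
qed

lemma A5_words_distinct: "distinct A5_words" and A5_words_length: "length A5_words = 60"
  by code_simp+

lemma A5_words_are_words: "xs \<in> set A5_words \<Longrightarrow> is_word xs"
proof -
  have "\<forall>xs\<in>set A5_words. is_word xs" by code_simp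
  then show "xs \<in> set A5_words \<Longrightarrow> is_word xs" by blast
qed

lemma GA_comp: "p \<in> GA \<Longrightarrow> q \<in> GA \<Longrightarrow> p \<circ> q \<in> GA"
  using group.subgroup_self monoid.m_closed[OF group.is_monoid[OF alt_group_is_group[of 5]]]
  by (simp add: alt_group_mult)

lemma id_in_GA: "id \<in> GA"
  using monoid.one_closed[OF group.is_monoid[OF alt_group_is_group[of 5]]] by (simp add: alt_group_one)

lemma two_transpositions_in_GA:
  assumes "a \<in> {1..5}" "b \<in> {1..5}" "c \<in> {1..5}" "d \<in> {1..5}" "a \<noteq> b" "c \<noteq> d"
  shows "transpose a b \<circ> transpose c d \<in> GA"
  using assms unfolding alt_group_carrier
  by (auto intro!: permutes_compose permutes_swap_id
      simp: evenperm_comp permutation_swap_id evenperm_swap)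

text \<open>Each generator is a product of two or four transpositions, hence even.\<close>

lemma A5_words_in_GA: "xs \<in> set A5_words \<Longrightarrow> perm_of xs \<in> GA"
proof -
  have gens: "perm_of [0,1,2,3,4] = id"
    "perm_of [1,0,3,2,4] = transpose 1 2 \<circ> transpose 3 4"
    "perm_of [2,3,0,1,4] = transpose 1 3 \<circ> transpose 2 4"
    "perm_of [3,2,1,0,4] = transpose 1 4 \<circ> transpose 2 3"
    "perm_of [1,2,0,3,4] = transpose 1 2 \<circ> transpose 2 3"
    "perm_of [1,2,3,4,0] = (transpose 1 2 \<circ> transpose 2 3) \<circ> (transpose 3 4 \<circ> transpose 4 5)"
    by (rule ext; auto simp: perm_of_def transpose_def nth_Cons' Suc_le_eq)+
  have mem: "perm_of [0,1,2,3,4] \<in> GA" "perm_of [1,0,3,2,4] \<in> GA" "perm_of [2,3,0,1,4] \<in> GA"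
    "perm_of [3,2,1,0,4] \<in> GA" "perm_of [1,2,0,3,4] \<in> GA" "perm_of [1,2,3,4,0] \<in> GA"
    unfolding gens by (intro GA_comp two_transpositions_in_GA id_in_GA; simp)+
  have w: "is_word [0,1,2,3,4]" "is_word [1,0,3,2,4]" "is_word [2,3,0,1,4]" "is_word [3,2,1,0,4]"
    "is_word [1,2,0,3,4]" "is_word [2,0,1,3,4]" "is_word [1,2,3,4,0]"
    "is_word [2,3,4,0,1]" "is_word [3,4,0,1,2]" "is_word [4,0,1,2,3]"
    by (simp_all add: is_word_def)
  define good where "good xs \<longleftrightarrow> is_word xs \<and> perm_of xs \<in> GA" for xs
  have good_comp: "good xs \<Longrightarrow> good ys \<Longrightarrow> good (word_comp xs ys)" for xs ys
    by (simp add: good_def is_word_comp perm_of_comp GA_comp)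
  have base: "good [0,1,2,3,4]" "good [1,0,3,2,4]" "good [2,3,0,1,4]" "good [3,2,1,0,4]"
    "good [1,2,0,3,4]" "good [1,2,3,4,0]"
    using mem w by (simp_all add: good_def)
  have powers: "good [2,0,1,3,4]" "good [2,3,4,0,1]" "good [3,4,0,1,2]" "good [4,0,1,2,3]"
    using good_comp[OF base(5) base(5)] good_comp[OF base(6) base(6)]
      good_comp[OF base(6) good_comp[OF base(6) base(6)]]
      good_comp[OF base(6) good_comp[OF base(6) good_comp[OF base(6) base(6)]]]
    by (simp_all add: word_comp_def)
  have "\<forall>v\<in>set V4_words. good v" "\<forall>t\<in>set C3_words. good t" "\<forall>c\<in>set C5_words. good c"
    using base powers by (simp_all add: V4_words_def C3_words_def C5_words_def)
  then have "\<forall>xs\<in>set A5_words. good xs"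
    by (auto simp: A5_words_def A4_words_def intro!: good_comp)
  then show "xs \<in> set A5_words \<Longrightarrow> perm_of xs \<in> GA" by (simp add: good_def)
qed

lemma perm_of_inj: "inj_on perm_of (set A5_words)"
  by (auto intro!: inj_onI perm_of_inject A5_words_are_words)

lemma card_GA: "card GA = 60"
  using alt_group_card_carrier[of 5] by (simp add: fact_numeral)

lemma finite_GA: "finite GA"
  using card_GA by (metis card.infinite zero_neq_numeral)

text \<open>Only one inclusion is proved elementwise; \<open>A\<^sub>5\<close> has \<open>60\<close> elements and there are \<open>60\<close> different
words.\<close>

lemma GA_eq: "GA = perm_of ` set A5_words"
  by (rule card_subset_eq[symmetric])
     (auto simp: finite_GA A5_words_in_GA card_GA card_image[OF perm_of_inj]
        distinct_card[OF A5_words_distinct] A5_words_length)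

text \<open>The rational characters of \<open>A\<^sub>5\<close> as functions of the number \<open>k\<close> of fixed points in \<open>{1..5}\<close>. The
index \<open>d\<close> is the degree of the irreducible constituents: \<open>d = 4, 5\<close> are irreducible characters,
while \<open>d = 3\<close> is the sum of the two algebraically conjugate characters of degree \<open>3\<close>, which
separately take the irrational values \<open>(1 \<plusminus> \<surd>5)/2\<close> on five-cycles.\<close>

definition char_val :: "nat \<Rightarrow> nat \<Rightarrow> int" where
  "char_val d k =
    (if d = 3 then if k = 5 then 6 else if k = 1 then -2 else if k = 2 then 0 else 1
     else if d = 4 then int k - 1
     else if k = 5 then 5 else if k = 1 then 1 else if k = 2 then -1 else 0)"

definition class_size :: "nat \<Rightarrow> nat" where
  "class_size k = (if k = 5 then 1 else if k = 1 then 15 else if k = 2 then 20 else 24)"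

text \<open>The scalar by which the sum of the class \<open>k\<close> acts on the block of \<open>d\<close>, that is
\<open>|C| \<chi>(C) / \<chi>(1)\<close>. For \<open>d = 3\<close> both constituents give the same scalar, because \<open>k = 0\<close> collects
both conjugacy classes of five-cycles. All divisions are exact.\<close>

definition central_val :: "nat \<Rightarrow> nat \<Rightarrow> int" where
  "central_val d k = int (class_size k) * char_val d k div char_val d 5"

lemma word_fix_values: "\<forall>x\<in>set A5_words. word_fix x \<in> {0, 1, 2, 5}"
  by code_simp

lemma length_class_words: "\<forall>k\<in>set [5, 1, 2, 0]. length (class_words k) = class_size k"
  by code_simp

text \<open>This is the statement that the class sums act on the blocks as scalars, in the form of the
character identity \<open>\<Sum>\<^bsub>c \<in> C\<^esub> \<chi>(cx) = \<omega>(C) \<chi>(x)\<close>.\<close>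

lemma words_class_algebra:
  "\<forall>d\<in>set [3, 4, 5]. \<forall>k\<in>set [1, 2, 0]. \<forall>x\<in>set A5_words.
    (\<Sum>c\<leftarrow>class_words k. char_val d (word_fix (word_comp c x)))
      = central_val d k * char_val d (word_fix x)"
  by code_simp

section \<open>Conjugacy classes up to powers\<close>

text \<open>For \<open>k = 5, 1, 2\<close> these are the conjugacy classes of the identity, the involutions and the
three-cycles; \<open>cclass 0\<close> is the union of the two classes of five-cycles, which are exchanged by
squaring.\<close>

definition cclass :: "nat \<Rightarrow> (nat \<Rightarrow> nat) set" where
  "cclass k = {p \<in> GA. nfix p = k}"

lemma nfix_values: "p \<in> GA \<Longrightarrow> nfix p \<in> {0, 1, 2, 5}"
  using word_fix_values by (auto simp: GA_eq nfix_perm_of)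

lemma cclass_eq: "cclass k = perm_of ` set (class_words k)"
  by (auto simp: cclass_def GA_eq nfix_perm_of class_words_def)

lemma sum_cclass: "(\<Sum>c\<in>cclass k. F c) = (\<Sum>cs\<leftarrow>class_words k. F (perm_of cs))"
proof -
  have "inj_on perm_of (set (class_words k))" "distinct (class_words k)"
    using perm_of_inj A5_words_distinct by (auto simp: class_words_def inj_on_def)
  then show ?thesis
    by (simp add: cclass_eq sum.reindex sum_list_distinct_conv_sum_set)
qed

lemma card_cclass: "k \<in> {5, 1, 2, 0} \<Longrightarrow> card (cclass k) = class_size k"
proof -
  assume k: "k \<in> {5, 1, 2, 0}"
  have "card (cclass k) = (\<Sum>c\<in>cclass k. 1)" by simp
  also have "\<dots> = length (class_words k)" unfolding sum_cclass by (simp add: sum_list_triv)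
  also have "\<dots> = class_size k" using length_class_words k by auto
  finally show ?thesis .
qed

lemma cclass_5: "cclass 5 = {id}"
proof -
  have "{i \<in> {1..5}. id i = i} = {1..5::nat}" by auto
  then have "id \<in> cclass 5" by (simp add: cclass_def nfix_def id_in_GA)
  moreover have "card (cclass 5) = 1" by (simp add: card_cclass class_size_def)
  ultimately show ?thesis by (auto simp: card_Suc_eq One_nat_def)
qed

lemma sum_over_classes:
  "(\<Sum>x\<in>GA. F x) = (\<Sum>k\<in>{5, 1, 2, 0}. \<Sum>c\<in>cclass k. F c)"
proof -
  have vals: "nfix ` GA \<subseteq> {5, 1, 2, 0}" "finite {5, 1, 2, 0 :: nat}" using nfix_values by auto
  show ?thesis unfolding cclass_def by (rule sum.group[OF finite_GA vals(2,1), symmetric])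
qed

text \<open>The character identity checked on words, transported to permutations.\<close>

lemma class_algebra:
  assumes "d \<in> {3, 4, 5}" "k \<in> {5, 1, 2, 0}" "x \<in> GA"
  shows "(\<Sum>c\<in>cclass k. char_val d (nfix (c \<circ> x))) = central_val d k * char_val d (nfix x)"
proof (cases "k = 5")
  case True
  then show ?thesis using assms(1)
    by (auto simp: cclass_5 central_val_def class_size_def char_val_def)
next
  case False
  obtain xs where xs: "xs \<in> set A5_words" "x = perm_of xs" using assms(3) GA_eq by auto
  have "(\<Sum>c\<in>cclass k. char_val d (nfix (c \<circ> x)))
      = (\<Sum>c\<leftarrow>class_words k. char_val d (word_fix (word_comp c xs)))"
    by (simp add: sum_cclass xs flip: perm_of_comp[OF A5_words_are_words[OF xs(1)]] nfix_perm_of)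
  also have "\<dots> = central_val d k * char_val d (nfix x)"
    using words_class_algebra assms(1,2) False xs by (auto simp: nfix_perm_of)
  finally show ?thesis .
qed

lemma GA_inv: "p \<in> GA \<Longrightarrow> inv' p \<in> GA"
  by (rule alt_group_inv_closed)

lemma GA_inv_comp:
  assumes "p \<in> GA"
  shows "inv' p \<circ> p = id" "p \<circ> inv' p = id" "inv' (inv' p) = p"
  using assms by (auto simp: alt_group_carrier permutes_inv_o permutes_inv_inv)

lemma GA_cancel:
  assumes "p \<in> GA"
  shows "inv' p \<circ> (p \<circ> q) = q" "p \<circ> (inv' p \<circ> q) = q" "(q \<circ> p) \<circ> inv' p = q" "(q \<circ> inv' p) \<circ> p = q"
  using GA_inv_comp(1,2)[OF assms] by (metis comp_assoc id_comp comp_id)+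

lemma nfix_inv: "p \<in> GA \<Longrightarrow> nfix (inv' p) = nfix p"
proof -
  assume "p \<in> GA"
  then have "inv' p i = i \<longleftrightarrow> p i = i" for i
    by (metis alt_group_carrier permutes_inverses)
  then show ?thesis by (simp add: nfix_def)
qed

lemma sum_GA_left: "g \<in> GA \<Longrightarrow> (\<Sum>x\<in>GA. F (g \<circ> x)) = (\<Sum>x\<in>GA. F x)"
  by (rule sum.reindex_bij_witness[of _ "\<lambda>x. inv' g \<circ> x" "\<lambda>x. g \<circ> x"])
     (simp_all only: GA_cancel GA_comp GA_inv)

lemma sum_GA_right: "g \<in> GA \<Longrightarrow> (\<Sum>x\<in>GA. F (x \<circ> g)) = (\<Sum>x\<in>GA. F x)"
  by (rule sum.reindex_bij_witness[of _ "\<lambda>x. x \<circ> inv' g" "\<lambda>x. x \<circ> g"])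
     (simp_all only: GA_cancel GA_comp GA_inv)

lemma sum_GA_inv: "(\<Sum>x\<in>GA. F (inv' x)) = (\<Sum>x\<in>GA. F x)"
  by (rule sum.reindex_bij_witness[of _ inv' inv']) (simp_all only: GA_inv_comp GA_inv)

lemma sum_cclass_inv: "(\<Sum>x\<in>cclass k. F (inv' x)) = (\<Sum>x\<in>cclass k. F x)"
  by (rule sum.reindex_bij_witness[of _ inv' inv'])
     (simp_all add: cclass_def GA_inv_comp(3) GA_inv nfix_inv)

definition class_word :: "nat \<Rightarrow> nat list" where
  "class_word k = (if k = 5 then [0,1,2,3,4] else if k = 1 then [1,0,3,2,4]
    else if k = 2 then [1,2,0,3,4] else [1,2,3,4,0])"

text \<open>A class representative is conjugate to every element of its class, except that for five-cycles the
square of the representative is needed for the other conjugacy class. The equation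
\<open>y r = x y\<close> expresses \<open>x = y r y\<inverse>\<close> without inverses.\<close>

lemma words_conjugate:
  "\<forall>k\<in>set [5, 1, 2, 0]. \<forall>x\<in>set (class_words k). \<exists>y\<in>set A5_words.
      word_comp y (class_word k) = word_comp x y \<or>
      k = 0 \<and> word_comp y (word_comp (class_word k) (class_word k)) = word_comp x y"
  by code_simp

lemma class_word_in_A5_words: "class_word k \<in> set A5_words"
proof -
  have "set [[0,1,2,3,4], [1,0,3,2,4], [1,2,0,3,4], [1,2,3,4,0]] \<subseteq> set A5_words"
    by code_simp
  then show ?thesis by (auto simp: class_word_def)
qed

definition class_rep :: "nat \<Rightarrow> nat \<Rightarrow> nat" where
  "class_rep k = perm_of (class_word k)"

lemma class_rep_in_GA: "class_rep k \<in> GA"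
  by (simp add: class_rep_def A5_words_in_GA class_word_in_A5_words)

lemma conjugate_class_rep:
  assumes "x \<in> GA"
  obtains y where "y \<in> GA" "y \<circ> class_rep (nfix x) = x \<circ> y"
  | y where "nfix x = 0" "y \<in> GA" "y \<circ> (class_rep 0 \<circ> class_rep 0) = x \<circ> y"
proof -
  obtain xs where xs: "xs \<in> set A5_words" "x = perm_of xs" using assms by (auto simp: GA_eq)
  let ?w = "class_word (nfix x)"
  have "xs \<in> set (class_words (nfix x))" using xs by (simp add: class_words_def nfix_perm_of)
  then obtain ys where ys: "ys \<in> set A5_words" "word_comp ys ?w = word_comp xs ys \<or>
      nfix x = 0 \<and> word_comp ys (word_comp ?w ?w) = word_comp xs ys"
    using bspec[OF words_conjugate, of "nfix x"] nfix_values[OF assms] by fastforce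
  note w = A5_words_are_words[OF xs(1)] A5_words_are_words[OF ys(1)]
    A5_words_are_words[OF class_word_in_A5_words[of "nfix x"]]
  note y = A5_words_in_GA[OF ys(1)]
  from ys(2) show thesis
  proof
    assume "word_comp ys ?w = word_comp xs ys"
    from arg_cong[OF this, of perm_of] show thesis
      using that(1)[OF y] w by (simp add: perm_of_comp xs(2) class_rep_def)
  next
    assume *: "nfix x = 0 \<and> word_comp ys (word_comp ?w ?w) = word_comp xs ys"
    from arg_cong[OF conjunct2[OF this], of perm_of] show thesis
      using that(2)[OF conjunct1[OF *] y] w *
      by (simp add: perm_of_comp is_word_comp xs(2) class_rep_def)
  qed
qed

text \<open>With \<open>c\<close> of order five, \<open>c\<close> is the cube of \<open>c\<^sup>2\<close>. So \<open>c\<close> and \<open>c\<^sup>2\<close> have the same fixed points in every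
action, although they are not conjugate.\<close>

lemma class_rep_0_power:
  "(class_rep 0 \<circ> class_rep 0) \<circ> ((class_rep 0 \<circ> class_rep 0) \<circ> (class_rep 0 \<circ> class_rep 0)) = class_rep 0"
proof -
  let ?w = "[1,2,3,4,0]" let ?w2 = "word_comp ?w ?w"
  have w: "is_word ?w" by (simp add: is_word_def)
  have "word_comp ?w2 (word_comp ?w2 ?w2) = ?w" by (simp add: word_comp_def)
  then have "perm_of ?w = perm_of (word_comp ?w2 (word_comp ?w2 ?w2))" by simp
  also have "\<dots> = perm_of ?w2 \<circ> (perm_of ?w2 \<circ> perm_of ?w2)"
    using w by (simp only: perm_of_comp is_word_comp)
  finally have power: "perm_of ?w = perm_of ?w2 \<circ> (perm_of ?w2 \<circ> perm_of ?w2)" .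
  have square: "perm_of ?w2 = perm_of ?w \<circ> perm_of ?w" using w by (rule perm_of_comp)
  have rep: "class_rep 0 = perm_of ?w" by (simp add: class_rep_def class_word_def)
  show ?thesis unfolding rep by (rule power[unfolded square, symmetric])
qed

section \<open>Isotypic parts of functions on the group\<close>

definition class_sum :: "nat \<Rightarrow> ((nat \<Rightarrow> nat) \<Rightarrow> real) \<Rightarrow> (nat \<Rightarrow> nat) \<Rightarrow> real" where
  "class_sum k h g = (\<Sum>c\<in>cclass k. h (g \<circ> c))"

text \<open>Convolution with a character. Up to the factor \<open>60 / d\<close> this is the projection onto the block of
that character.\<close>

definition isotypic :: "nat \<Rightarrow> ((nat \<Rightarrow> nat) \<Rightarrow> real) \<Rightarrow> (nat \<Rightarrow> nat) \<Rightarrow> real" where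
  "isotypic d h g = (\<Sum>x\<in>GA. of_int (char_val d (nfix x)) * h (g \<circ> x))"

lemma sum_class_function:
  "(\<Sum>x\<in>GA. a (nfix x) * h (g \<circ> x)) = (\<Sum>k\<in>{5, 1, 2, 0}. a k * class_sum k h g)"
  by (simp add: sum_over_classes class_sum_def cclass_def sum_distrib_left)

lemma class_sum_5 [simp]: "class_sum 5 h g = h g"
  by (simp add: class_sum_def cclass_5)

lemma isotypic_eq_class_sums: "isotypic d h g = (\<Sum>k\<in>{5, 1, 2, 0}. of_int (char_val d k) * class_sum k h g)"
  unfolding isotypic_def by (rule sum_class_function)

text \<open>Shifting the summation variable moves the class sum from the function to the character, where
\<open>class_algebra\<close> applies.\<close>

lemma class_sum_isotypic:
  assumes "d \<in> {3, 4, 5}" "k \<in> {5, 1, 2, 0}" "g \<in> GA"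
  shows "class_sum k (isotypic d h) g = of_int (central_val d k) * isotypic d h g"
proof -
  let ?\<chi> = "\<lambda>x. real_of_int (char_val d (nfix x))"
  have "class_sum k (isotypic d h) g = (\<Sum>c\<in>cclass k. \<Sum>x\<in>GA. ?\<chi> x * h (g \<circ> (c \<circ> x)))"
    by (simp add: class_sum_def isotypic_def comp_assoc)
  also have "\<dots> = (\<Sum>c\<in>cclass k. \<Sum>x\<in>GA. ?\<chi> (inv' c \<circ> x) * h (g \<circ> x))"
  proof (rule sum.cong[OF refl])
    fix c assume "c \<in> cclass k"
    then have c: "c \<in> GA" by (simp add: cclass_def)
    show "(\<Sum>x\<in>GA. ?\<chi> x * h (g \<circ> (c \<circ> x))) = (\<Sum>x\<in>GA. ?\<chi> (inv' c \<circ> x) * h (g \<circ> x))"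
      using sum_GA_left[OF c, of "\<lambda>x. ?\<chi> (inv' c \<circ> x) * h (g \<circ> x)"] by (simp add: GA_cancel[OF c])
  qed
  also have "\<dots> = (\<Sum>x\<in>GA. (\<Sum>c\<in>cclass k. ?\<chi> (inv' c \<circ> x)) * h (g \<circ> x))"
    by (subst sum.swap) (simp add: sum_distrib_right)
  also have "\<dots> = (\<Sum>x\<in>GA. (of_int (central_val d k) * ?\<chi> x) * h (g \<circ> x))"
  proof (rule sum.cong[OF refl])
    fix x assume x: "x \<in> GA"
    have "(\<Sum>c\<in>cclass k. ?\<chi> (inv' c \<circ> x)) = (\<Sum>c\<in>cclass k. ?\<chi> (c \<circ> x))"
      by (rule sum_cclass_inv)
    also have "\<dots> = of_int (central_val d k) * ?\<chi> x"
      using arg_cong[OF class_algebra[OF assms(1,2) x], of real_of_int] by simp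
    finally show "(\<Sum>c\<in>cclass k. ?\<chi> (inv' c \<circ> x)) * h (g \<circ> x)
      = (of_int (central_val d k) * ?\<chi> x) * h (g \<circ> x)" by simp
  qed
  also have "\<dots> = of_int (central_val d k) * isotypic d h g"
    by (simp add: isotypic_def sum_distrib_left mult.assoc)
  finally show ?thesis .
qed

text \<open>So convolution with a function of the number of fixed points is a scalar on each block.\<close>

lemma class_function_isotypic:
  assumes "d \<in> {3, 4, 5}" "g \<in> GA"
  shows "(\<Sum>k\<in>{5, 1, 2, 0}. a k * class_sum k (isotypic d h) g)
    = (\<Sum>k\<in>{5, 1, 2, 0}. a k * of_int (central_val d k)) * isotypic d h g"
  unfolding sum_distrib_right
  by (intro sum.cong refl) (simp only: class_sum_isotypic[OF assms(1) _ assms(2)] mult.assoc)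

text \<open>The factor is \<open>60 / d\<close>, that is \<open>\<Sum>\<^sub>C \<chi>(C) \<omega>(C)\<close>.\<close>

lemma isotypic_twice:
  assumes "d \<in> {3, 4, 5}" "g \<in> GA"
  shows "isotypic d (isotypic d h) g = (if d = 3 then 20 else if d = 4 then 15 else 12) * isotypic d h g"
  unfolding isotypic_eq_class_sums[of d "isotypic d h"] class_function_isotypic[OF assms]
  using assms(1) by (auto simp: central_val_def class_size_def char_val_def)

text \<open>The regular character \<open>1 + 3\<rho> + 4\<chi>\<^sub>4 + 5\<chi>\<^sub>5\<close> is \<open>60\<close> at the identity and zero elsewhere.\<close>

lemma isotypic_decomposition:
  assumes "g \<in> GA"
  shows "60 * h g = (\<Sum>x\<in>GA. h x) + 3 * isotypic 3 h g + 4 * isotypic 4 h g + 5 * isotypic 5 h g"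
proof -
  have "(\<Sum>x\<in>GA. h x) = (\<Sum>k\<in>{5, 1, 2, 0}. 1 * class_sum k h g)"
    using sum_class_function[of "\<lambda>_. 1" h g] sum_GA_left[OF assms, of h] by simp
  then show ?thesis by (simp add: isotypic_eq_class_sums char_val_def)
qed

text \<open>The characters are real, so they take the same value at an element and at its inverse.\<close>

lemma isotypic_symmetric:
  "(\<Sum>g\<in>GA. u g * isotypic d h g) = (\<Sum>g\<in>GA. isotypic d u g * h g)"
proof -
  let ?\<chi> = "\<lambda>x. real_of_int (char_val d (nfix x))"
  have "(\<Sum>g\<in>GA. u g * isotypic d h g) = (\<Sum>x\<in>GA. ?\<chi> x * (\<Sum>g\<in>GA. u g * h (g \<circ> x)))"
    unfolding isotypic_def sum_distrib_left by (subst sum.swap) (simp add: mult_ac)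
  also have "\<dots> = (\<Sum>x\<in>GA. ?\<chi> (inv' x) * (\<Sum>g\<in>GA. u (g \<circ> inv' x) * h g))"
  proof (rule sum.cong[OF refl])
    fix x assume x: "x \<in> GA"
    show "?\<chi> x * (\<Sum>g\<in>GA. u g * h (g \<circ> x))
      = ?\<chi> (inv' x) * (\<Sum>g\<in>GA. u (g \<circ> inv' x) * h g)"
      using sum_GA_right[OF x, of "\<lambda>g. u (g \<circ> inv' x) * h g"] by (simp add: GA_cancel[OF x] nfix_inv x)
  qed
  also have "\<dots> = (\<Sum>x\<in>GA. ?\<chi> x * (\<Sum>g\<in>GA. u (g \<circ> x) * h g))"
    by (rule sum_GA_inv)
  also have "\<dots> = (\<Sum>g\<in>GA. isotypic d u g * h g)"
    unfolding isotypic_def sum_distrib_left sum_distrib_right by (subst sum.swap) (simp add: mult_ac)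
  finally show ?thesis .
qed

text \<open>The operators are symmetric and idempotent up to a positive factor, so their quadratic forms are
sums of squares. This gives both the ratio bounds and the vanishing in the equality case.\<close>

lemma isotypic_form:
  assumes "d \<in> {3, 4, 5}"
  shows "(if d = 3 then 20 else if d = 4 then 15 else 12) * (\<Sum>g\<in>GA. h g * isotypic d h g)
    = (\<Sum>g\<in>GA. (isotypic d h g)\<^sup>2)"
proof -
  have "(\<Sum>g\<in>GA. (isotypic d h g)\<^sup>2) = (\<Sum>g\<in>GA. h g * isotypic d (isotypic d h) g)"
    unfolding power2_eq_square by (rule isotypic_symmetric[symmetric])
  also have "\<dots> = (if d = 3 then 20 else if d = 4 then 15 else 12) * (\<Sum>g\<in>GA. h g * isotypic d h g)"
    unfolding sum_distrib_left by (intro sum.cong refl) (simp add: isotypic_twice[OF assms])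
  finally show ?thesis by simp
qed

lemma isotypic_form_nonneg:
  assumes "d \<in> {3, 4, 5}"
  shows "0 \<le> (\<Sum>g\<in>GA. h g * isotypic d h g)"
proof -
  have "0 \<le> (\<Sum>g\<in>GA. (isotypic d h g)\<^sup>2)" by (simp add: sum_nonneg)
  then show ?thesis unfolding isotypic_form[OF assms, symmetric] by (simp add: zero_le_mult_iff split: if_splits)
qed

lemma isotypic_eq_0:
  assumes "d \<in> {3, 4, 5}" "(\<Sum>g\<in>GA. h g * isotypic d h g) = 0" "g \<in> GA"
  shows "isotypic d h g = 0"
proof -
  have "(\<Sum>g\<in>GA. (isotypic d h g)\<^sup>2) = 0"
    using assms(2) unfolding isotypic_form[OF assms(1), symmetric] by simp
  then show ?thesis using assms(3) by (simp add: sum_nonneg_eq_0_iff finite_GA)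
qed

section \<open>Pairs of elements with quotient in a given class\<close>

text \<open>The number of pairs \<open>(x, y) \<in> S \<times> S\<close> with \<open>x\<inverse>y\<close> in the class \<open>k\<close>.\<close>

definition class_pairs :: "(nat \<Rightarrow> nat) set \<Rightarrow> nat \<Rightarrow> real" where
  "class_pairs S k = (\<Sum>g\<in>S. class_sum k (\<lambda>x. of_bool (x \<in> S)) g)"

lemma class_pairs_5: "class_pairs S 5 = card S"
  by (simp add: class_pairs_def)

lemma class_pairs_sum:
  assumes "S \<subseteq> GA"
  shows "(\<Sum>k\<in>{5, 1, 2, 0}. class_pairs S k) = (card S)\<^sup>2"
proof -
  let ?f = "\<lambda>x. of_bool (x \<in> S) :: real"
  have "(\<Sum>k\<in>{5, 1, 2, 0}. class_pairs S k) = (\<Sum>g\<in>S. \<Sum>k\<in>{5, 1, 2, 0}. 1 * class_sum k ?f g)"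
    unfolding class_pairs_def by (subst sum.swap) simp
  also have "\<dots> = (\<Sum>g\<in>S. \<Sum>x\<in>GA. ?f x)"
  proof (rule sum.cong[OF refl])
    fix g assume "g \<in> S"
    then have g: "g \<in> GA" using assms by blast
    show "(\<Sum>k\<in>{5, 1, 2, 0}. 1 * class_sum k ?f g) = (\<Sum>x\<in>GA. ?f x)"
      using sum_class_function[of "\<lambda>_. 1" ?f g] sum_GA_left[OF g, of ?f] by simp
  qed
  also have "(\<Sum>x\<in>GA. ?f x) = card S"
    using assms finite_GA by (simp add: sum_of_bool_eq Int_absorb1)
  finally show ?thesis by (simp add: power2_eq_square)
qed

text \<open>The quadratic form of a block at the indicator function of \<open>S\<close> is \<open>\<Sum>\<^bsub>x, y \<in> S\<^esub> \<chi>(x\<inverse>y)\<close>, sorted by the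
class of the quotient.\<close>

lemma isotypic_form_class_pairs:
  assumes "S \<subseteq> GA"
  shows "(\<Sum>g\<in>GA. of_bool (g \<in> S) * isotypic d (\<lambda>x. of_bool (x \<in> S)) g)
    = (\<Sum>k\<in>{5, 1, 2, 0}. of_int (char_val d k) * class_pairs S k)"
proof -
  let ?f = "\<lambda>x. of_bool (x \<in> S) :: real"
  have "(\<Sum>g\<in>GA. ?f g * isotypic d ?f g) = (\<Sum>g\<in>S. isotypic d ?f g)"
    using assms finite_GA by (intro sum.mono_neutral_cong_right) auto
  also have "\<dots> = (\<Sum>k\<in>{5, 1, 2, 0}. of_int (char_val d k) * class_pairs S k)"
    unfolding isotypic_eq_class_sums class_pairs_def sum_distrib_left by (rule sum.swap)
  finally show ?thesis .
qed

text \<open>The equation \<open>r t = s\<close> says that \<open>r\<close> is the quotient \<open>s t\<inverse>\<close>.\<close>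

definition quotients_in :: "nat list list \<Rightarrow> nat set \<Rightarrow> bool" where
  "quotients_in L K \<longleftrightarrow> distinct L \<and> set L \<subseteq> set A5_words \<and>
    (\<forall>s\<in>set L. \<forall>t\<in>set L. \<exists>r\<in>set A5_words. word_comp r t = s \<and> word_fix r \<in> K)"

text \<open>These subgroups are intersecting sets whenever all their elements have fixed points, and so bound
the size of a maximum intersecting set from below.\<close>

lemma quotients_in_subgroups:
  "quotients_in V4_words {5, 1}" "quotients_in C5_words {5, 0}"
  "quotients_in A4_words {5, 1, 2}" "quotients_in D5_words {5, 1, 0}"
  by code_simp+

lemma subgroup_lengths:
  "length V4_words = 4" "length C5_words = 5" "length A4_words = 12" "length D5_words = 10"
  by code_simp+

section \<open>Canonical vectors and the permutation character\<close>

definition fun_vec :: "((nat \<Rightarrow> nat) \<Rightarrow> real) \<Rightarrow> (nat \<Rightarrow> nat) \<Rightarrow>\<^sub>0 complex" where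
  "fun_vec h = (\<Sum>g\<in>GA. Poly_Mapping.single g (of_real (h g)))"

lemma lookup_sum_single:
  "finite A \<Longrightarrow> Poly_Mapping.lookup (\<Sum>t\<in>A. Poly_Mapping.single t (c t)) g = (if g \<in> A then c g else 0)"
  by (simp add: lookup_sum lookup_single when_def sum.delta' cong: if_cong)

lemma lookup_fun_vec: "Poly_Mapping.lookup (fun_vec h) g = (if g \<in> GA then of_real (h g) else 0)"
  unfolding fun_vec_def by (rule lookup_sum_single[OF finite_GA])

lemma of_real_of_bool: "complex_of_real (of_bool P) = of_bool P"
  by (cases P) simp_all

lemma fun_vec_cong: "(\<And>g. g \<in> GA \<Longrightarrow> h g = h' g) \<Longrightarrow> fun_vec h = fun_vec h'"
  by (simp add: fun_vec_def cong: sum.cong)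

lemma fun_vec_add: "fun_vec (\<lambda>g. h g + h' g) = fun_vec h + fun_vec h'"
  by (simp add: fun_vec_def single_add sum.distrib)

lemma fun_vec_scale: "fun_vec (\<lambda>g. c * h g) = ga_scale (of_real c) (fun_vec h)"
  by (rule poly_mapping_eqI) (simp add: lookup_fun_vec)

lemma char_vec_eq: "S \<subseteq> GA \<Longrightarrow> char_vec S = fun_vec (\<lambda>g. of_bool (g \<in> S))"
  by (rule poly_mapping_eqI)
     (use finite_subset[OF _ finite_GA] in \<open>auto simp: char_vec_def lookup_sum_single lookup_fun_vec\<close>)

text \<open>A transitive action on the empty set is possible; it is excluded here because the all-one function
is then not a combination of canonical vectors.\<close>

locale A5_action = transitive_action "alt_group 5" \<Omega> \<phi>
  for \<Omega> :: "'b set" and \<phi> +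
  assumes nonempty: "\<Omega> \<noteq> {}"
begin

text \<open>The permutation character, as a function of the number of points of \<open>{1..5}\<close> fixed by the element
rather than of the element itself.\<close>

definition perm_char :: "nat \<Rightarrow> nat" where
  "perm_char k = card (invariants \<Omega> \<phi> (class_rep k))"

abbreviation canonical_span where
  "canonical_span \<equiv> group_algebra.span {canonical_vec A5 \<phi> \<alpha> \<beta> | \<alpha> \<beta>. \<alpha> \<in> \<Omega> \<and> \<beta> \<in> \<Omega>}"

lemma act_comp: "p \<in> GA \<Longrightarrow> q \<in> GA \<Longrightarrow> \<alpha> \<in> \<Omega> \<Longrightarrow> \<phi> (p \<circ> q) \<alpha> = \<phi> p (\<phi> q \<alpha>)"
  using composition_rule[of \<alpha> p q] by (simp add: alt_group_mult)

lemma act_closed: "p \<in> GA \<Longrightarrow> \<alpha> \<in> \<Omega> \<Longrightarrow> \<phi> p \<alpha> \<in> \<Omega>"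
  using element_image by blast

lemma act_inject: "p \<in> GA \<Longrightarrow> \<alpha> \<in> \<Omega> \<Longrightarrow> \<beta> \<in> \<Omega> \<Longrightarrow> \<phi> p \<alpha> = \<phi> p \<beta> \<longleftrightarrow> \<alpha> = \<beta>"
  using inj_prop by (meson inj_on_eq_iff)

lemma finite_points: "finite \<Omega>"
proof -
  obtain \<alpha> where \<alpha>: "\<alpha> \<in> \<Omega>" using nonempty by blast
  then have "\<Omega> \<subseteq> (\<lambda>g. \<phi> g \<alpha>) ` GA" using unique_orbit by blast
  then show ?thesis using finite_GA finite_surj by blast
qed

lemma card_invariants_conj:
  assumes "y \<in> GA" "r \<in> GA" "x \<in> GA" "y \<circ> r = x \<circ> y"
  shows "card (invariants \<Omega> \<phi> x) = card (invariants \<Omega> \<phi> r)"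
proof -
  have eq: "\<phi> x (\<phi> y \<alpha>) = \<phi> y (\<phi> r \<alpha>)" if "\<alpha> \<in> \<Omega>" for \<alpha>
    using that assms by (metis act_comp)
  have "\<phi> y ` invariants \<Omega> \<phi> r = invariants \<Omega> \<phi> x"
  proof (intro equalityI subsetI)
    fix \<beta> assume "\<beta> \<in> \<phi> y ` invariants \<Omega> \<phi> r"
    then show "\<beta> \<in> invariants \<Omega> \<phi> x" using eq assms by (auto simp: invariants_def act_closed)
  next
    fix \<beta> assume \<beta>: "\<beta> \<in> invariants \<Omega> \<phi> x"
    then have "\<beta> \<in> \<phi> y ` \<Omega>" unfolding surj_prop[OF assms(1)] by (simp add: invariants_def)
    then obtain \<alpha> where \<alpha>: "\<alpha> \<in> \<Omega>" "\<phi> y \<alpha> = \<beta>" by blast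
    then have "\<phi> y (\<phi> r \<alpha>) = \<phi> y \<alpha>" using eq[OF \<alpha>(1)] \<alpha>(2) \<beta> by (simp add: invariants_def)
    then have "\<phi> r \<alpha> = \<alpha>"
      using act_inject[OF assms(1) act_closed[OF assms(2) \<alpha>(1)] \<alpha>(1)] by blast
    then have "\<alpha> \<in> invariants \<Omega> \<phi> r" using \<alpha>(1) by (simp add: invariants_def)
    then show "\<beta> \<in> \<phi> y ` invariants \<Omega> \<phi> r" using \<alpha> by blast
  qed
  moreover have "inj_on (\<phi> y) (invariants \<Omega> \<phi> r)"
    using inj_prop[OF assms(1)] by (rule inj_on_subset) (auto simp: invariants_def)
  ultimately show ?thesis by (metis card_image)
qed

lemma invariants_comp:
  "p \<in> GA \<Longrightarrow> q \<in> GA \<Longrightarrow> invariants \<Omega> \<phi> p \<inter> invariants \<Omega> \<phi> q \<subseteq> invariants \<Omega> \<phi> (p \<circ> q)"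
  by (auto simp: invariants_def act_comp)

text \<open>Conjugate elements have equally many fixed points. A five-cycle may instead be conjugate to the
square of the representative, which has the same fixed points as the representative.\<close>

lemma card_invariants: "x \<in> GA \<Longrightarrow> card (invariants \<Omega> \<phi> x) = perm_char (nfix x)"
proof -
  assume x: "x \<in> GA"
  then show ?thesis
  proof (cases rule: conjugate_class_rep)
    case (1 y)
    then show ?thesis using card_invariants_conj[OF 1(1) class_rep_in_GA x 1(2)] by (simp add: perm_char_def)
  next
    case (2 y)
    let ?c = "class_rep 0" and ?I = "invariants \<Omega> \<phi>"
    note c = class_rep_in_GA[of 0]
    note cc = GA_comp[OF c c]
    have "?I ?c \<subseteq> ?I (?c \<circ> ?c)" using invariants_comp[OF c c] by blast
    moreover have "?I (?c \<circ> ?c) \<subseteq> ?I ?c"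
      using invariants_comp[OF cc GA_comp[OF cc cc]] invariants_comp[OF cc cc]
      unfolding class_rep_0_power by blast
    ultimately show ?thesis
      using card_invariants_conj[OF 2(2) cc x 2(3)] 2(1) by (simp add: perm_char_def)
  qed
qed

lemma perm_char_5: "perm_char 5 = card \<Omega>"
proof -
  have "id \<in> cclass 5" by (simp add: cclass_5)
  then have "nfix id = 5" by (simp add: cclass_def)
  moreover have "\<phi> id = (\<lambda>\<alpha>\<in>\<Omega>. \<alpha>)" using id_eq_one by (simp add: alt_group_one)
  then have "invariants \<Omega> \<phi> id = \<Omega>" by (auto simp: invariants_def)
  ultimately show ?thesis using card_invariants[OF id_in_GA] by simp
qed

lemma perm_char_5_pos: "perm_char 5 > 0"
  using perm_char_5 finite_points nonempty by (simp add: card_gt_0_iff)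

text \<open>Burnside's lemma for a single orbit.\<close>

lemma orbit_counting: "perm_char 5 + 15 * perm_char 1 + 20 * perm_char 2 + 24 * perm_char 0 = 60"
proof -
  have "60 = card (orbits A5 \<Omega> \<phi>) * order A5"
    using one_orbit[OF nonempty] card_GA by (simp add: order_def)
  also have "\<dots> = (\<Sum>g\<in>GA. card (invariants \<Omega> \<phi> g))"
    by (rule burnside[OF finite_GA finite_points])
  also have "\<dots> = (\<Sum>k\<in>{5, 1, 2, 0}. \<Sum>c\<in>cclass k. perm_char k)"
    unfolding sum_over_classes by (intro sum.cong refl) (simp add: cclass_def card_invariants)
  also have "\<dots> = (\<Sum>k\<in>{5, 1, 2, 0}. class_size k * perm_char k)"
    by (intro sum.cong refl) (simp only: sum_constant card_cclass of_nat_id)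
  finally show ?thesis by (simp add: class_size_def)
qed

lemma lookup_canonical_vec:
  "Poly_Mapping.lookup (canonical_vec A5 \<phi> \<alpha> \<beta>) g = of_bool (g \<in> GA \<and> \<phi> g \<alpha> = \<beta>)"
  by (simp add: canonical_vec_def lookup_sum_single finite_GA)

text \<open>Each group element maps \<open>\<alpha>\<close> to exactly one \<open>\<beta>\<close>, so for every \<open>\<alpha>\<close> the sum \<open>\<Sum>\<^sub>\<beta> v\<^bsub>\<alpha>,\<beta>\<^esub>\<close> is that of all
group elements.\<close>

lemma const_in_canonical_span: "fun_vec (\<lambda>g. c) \<in> canonical_span"
proof -
  obtain \<alpha> where \<alpha>: "\<alpha> \<in> \<Omega>" using nonempty by blast
  have "fun_vec (\<lambda>g. c) = ga_scale (of_real c) (\<Sum>\<beta>\<in>\<Omega>. canonical_vec A5 \<phi> \<alpha> \<beta>)"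
  proof (rule poly_mapping_eqI)
    fix g
    have "(\<Sum>\<beta>\<in>\<Omega>. of_bool (g \<in> GA \<and> \<phi> g \<alpha> = \<beta>)) = (of_bool (g \<in> GA) :: complex)"
      using sum.delta'[OF finite_points, of "\<phi> g \<alpha>" "\<lambda>_. 1 :: complex"] act_closed[OF _ \<alpha>]
      by (cases "g \<in> GA") (simp_all add: of_bool_def)
    then show "Poly_Mapping.lookup (fun_vec (\<lambda>g. c)) g =
      Poly_Mapping.lookup (ga_scale (of_real c) (\<Sum>\<beta>\<in>\<Omega>. canonical_vec A5 \<phi> \<alpha> \<beta>)) g"
      by (simp add: lookup_fun_vec lookup_sum lookup_canonical_vec)
  qed
  also have "\<dots> \<in> canonical_span"
    using \<alpha> by (intro group_algebra.span_scale group_algebra.span_sum group_algebra.span_base) blast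
  finally show ?thesis .
qed

text \<open>The combination \<open>\<Sum>\<^sub>s h(s) \<Sum>\<^sub>\<alpha> v\<^bsub>\<alpha>,s\<alpha>\<^esub>\<close> has at \<open>g\<close> the coefficient \<open>\<Sum>\<^sub>s h(s) |{\<alpha>. g\<alpha> = s\<alpha>}|\<close>, and the
number of such \<open>\<alpha>\<close> is the value of the permutation character at \<open>g\<inverse>s\<close>.\<close>

lemma perm_char_sum_in_canonical_span: "fun_vec (\<lambda>g. \<Sum>k\<in>{5, 1, 2, 0}. real (perm_char k) * class_sum k h g) \<in> canonical_span"
proof -
  have "fun_vec (\<lambda>g. \<Sum>k\<in>{5, 1, 2, 0}. real (perm_char k) * class_sum k h g)
    = (\<Sum>s\<in>GA. \<Sum>\<alpha>\<in>\<Omega>. ga_scale (of_real (h s)) (canonical_vec A5 \<phi> \<alpha> (\<phi> s \<alpha>)))"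
  proof (rule poly_mapping_eqI)
    fix g
    have "(\<Sum>k\<in>{5, 1, 2, 0}. real (perm_char k) * class_sum k h g)
      = (\<Sum>s\<in>GA. h s * (\<Sum>\<alpha>\<in>\<Omega>. of_bool (\<phi> g \<alpha> = \<phi> s \<alpha>)))" if g: "g \<in> GA"
    proof -
      have "(\<Sum>k\<in>{5, 1, 2, 0}. real (perm_char k) * class_sum k h g)
        = (\<Sum>x\<in>GA. real (perm_char (nfix x)) * h (g \<circ> x))" by (rule sum_class_function[symmetric])
      also have "\<dots> = (\<Sum>x\<in>GA. h (g \<circ> x) * (\<Sum>\<alpha>\<in>\<Omega>. of_bool (\<phi> g \<alpha> = \<phi> (g \<circ> x) \<alpha>)))"
      proof (rule sum.cong[OF refl])
        fix x assume x: "x \<in> GA"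
        have "(\<Sum>\<alpha>\<in>\<Omega>. of_bool (\<phi> g \<alpha> = \<phi> (g \<circ> x) \<alpha>)) = (\<Sum>\<alpha>\<in>\<Omega>. of_bool (\<phi> x \<alpha> = \<alpha>) :: real)"
          using g x by (intro sum.cong refl) (auto simp: act_comp act_closed act_inject)
        also have "\<dots> = real (card (invariants \<Omega> \<phi> x))"
          using finite_points by (simp add: invariants_def sum_of_bool_eq Int_def)
        finally show "real (perm_char (nfix x)) * h (g \<circ> x)
          = h (g \<circ> x) * (\<Sum>\<alpha>\<in>\<Omega>. of_bool (\<phi> g \<alpha> = \<phi> (g \<circ> x) \<alpha>))"
          by (simp add: card_invariants x)
      qed
      also have "\<dots> = (\<Sum>s\<in>GA. h s * (\<Sum>\<alpha>\<in>\<Omega>. of_bool (\<phi> g \<alpha> = \<phi> s \<alpha>)))"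
        by (rule sum_GA_left[OF g])
      finally show ?thesis .
    qed
    then show "Poly_Mapping.lookup (fun_vec (\<lambda>g. \<Sum>k\<in>{5, 1, 2, 0}. real (perm_char k) * class_sum k h g)) g =
      Poly_Mapping.lookup (\<Sum>s\<in>GA. \<Sum>\<alpha>\<in>\<Omega>. ga_scale (of_real (h s)) (canonical_vec A5 \<phi> \<alpha> (\<phi> s \<alpha>))) g"
      unfolding lookup_fun_vec lookup_sum lookup_ga_scale lookup_canonical_vec
      by (simp add: sum_distrib_left of_real_of_bool)
  qed
  also have "\<dots> \<in> canonical_span"
    by (intro group_algebra.span_scale group_algebra.span_sum group_algebra.span_base)
       (auto intro: act_closed)
  finally show ?thesis .
qed

text \<open>The sum in the assumption is the eigenvalue of convolution with the permutation character on the
block of \<open>d\<close>. If it is not zero, the part of \<open>h\<close> in that block is a multiple of its own convolution,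
which lies in the span.\<close>

lemma fun_vec_in_canonical_span:
  assumes "\<And>d. d \<in> {3, 4, 5} \<Longrightarrow>
    (\<Sum>k\<in>{5, 1, 2, 0}. int (perm_char k) * central_val d k) \<noteq> 0 \<or> (\<forall>g\<in>GA. isotypic d h g = 0)"
  shows "fun_vec h \<in> canonical_span"
proof -
  have isotypic: "fun_vec (\<lambda>g. c * isotypic d h g) \<in> canonical_span" if d: "d \<in> {3, 4, 5}" for c d
  proof (cases "\<forall>g\<in>GA. isotypic d h g = 0")
    case True
    then have "fun_vec (\<lambda>g. c * isotypic d h g) = fun_vec (\<lambda>g. 0)" by (intro fun_vec_cong) simp
    then show ?thesis using const_in_canonical_span by simp
  next
    case False
    define e where "e = (\<Sum>k\<in>{5, 1, 2, 0}. real (perm_char k) * of_int (central_val d k))"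
    have "e = of_int (\<Sum>k\<in>{5, 1, 2, 0}. int (perm_char k) * central_val d k)" by (simp add: e_def)
    then have "e \<noteq> 0" using assms[OF d] False by (simp only: of_int_eq_0_iff) blast
    have "fun_vec (\<lambda>g. c * isotypic d h g)
      = fun_vec (\<lambda>g. c / e * (\<Sum>k\<in>{5, 1, 2, 0}. real (perm_char k) * class_sum k (isotypic d h) g))"
      by (intro fun_vec_cong) (simp only: class_function_isotypic[OF d] flip: e_def, simp add: \<open>e \<noteq> 0\<close>)
    then show ?thesis
      by (simp only: fun_vec_scale group_algebra.span_scale[OF perm_char_sum_in_canonical_span])
  qed
  have "fun_vec h = fun_vec (\<lambda>g. (\<Sum>x\<in>GA. h x) / 60 + (3 / 60 * isotypic 3 h g + (4 / 60 * isotypic 4 h g + 5 / 60 * isotypic 5 h g)))"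
    by (intro fun_vec_cong) (use isotypic_decomposition[of _ h] in \<open>simp add: field_simps\<close>)
  also have "\<dots> \<in> canonical_span"
    unfolding fun_vec_add by (intro group_algebra.span_add isotypic const_in_canonical_span) simp_all
  finally show ?thesis .
qed

section \<open>Ratio bounds for maximum intersecting sets\<close>

lemma intersect_iff:
  assumes "p \<in> GA" "q \<in> GA"
  shows "intersect A5 \<Omega> \<phi> p q \<longleftrightarrow> perm_char (nfix (p \<circ> inv' q)) > 0"
proof -
  have pq: "p \<circ> inv' q \<in> GA" using assms by (simp add: GA_comp GA_inv)
  have "intersect A5 \<Omega> \<phi> p q \<longleftrightarrow> invariants \<Omega> \<phi> (p \<circ> inv' q) \<noteq> {}"
    using assms by (auto simp: intersect_def invariants_def alt_group_mult alt_group_inv_equality)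
  also have "\<dots> \<longleftrightarrow> card (invariants \<Omega> \<phi> (p \<circ> inv' q)) > 0"
    using finite_points by (simp add: card_gt_0_iff invariants_def)
  finally show ?thesis by (simp add: card_invariants[OF pq])
qed

text \<open>Intersecting means that \<open>s t\<inverse>\<close> has a fixed point, while pairs are sorted by the class of \<open>t\<inverse>s\<close>;
the two quotients are conjugate.\<close>

lemma class_pairs_eq_0:
  assumes "intersecting_set A5 \<Omega> \<phi> S" "perm_char k = 0"
  shows "class_pairs S k = 0"
proof -
  have "g \<circ> c \<notin> S" if "g \<in> S" "c \<in> cclass k" for g c
  proof
    assume gc: "g \<circ> c \<in> S"
    have mem: "g \<in> GA" "c \<in> GA" "g \<circ> c \<in> GA"
      using that gc assms(1) by (auto simp: intersecting_set_def cclass_def)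
    have x: "(g \<circ> c) \<circ> inv' g \<in> GA" using mem by (simp add: GA_comp GA_inv)
    have "intersect A5 \<Omega> \<phi> (g \<circ> c) g" using assms(1) gc that(1) by (simp add: intersecting_set_def)
    then have "card (invariants \<Omega> \<phi> ((g \<circ> c) \<circ> inv' g)) > 0"
      using intersect_iff[OF mem(3,1)] card_invariants[OF x] by simp
    moreover have "card (invariants \<Omega> \<phi> ((g \<circ> c) \<circ> inv' g)) = card (invariants \<Omega> \<phi> c)"
      by (rule card_invariants_conj[OF mem(1,2) x]) (simp only: GA_cancel(4)[OF mem(1)])
    ultimately show False using that(2) assms(2) by (simp add: card_invariants mem cclass_def)
  qed
  then show ?thesis by (auto simp: class_pairs_def class_sum_def intro!: sum.neutral)
qed

lemma maximum_ge_words: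
  assumes "maximum_intersecting_set A5 \<Omega> \<phi> S" "quotients_in L K" "\<forall>k\<in>K. perm_char k > 0"
  shows "length L \<le> card S"
proof -
  have L: "distinct L" "set L \<subseteq> set A5_words" using assms(2) by (auto simp: quotients_in_def)
  have "intersect A5 \<Omega> \<phi> (perm_of s) (perm_of t)" if st: "s \<in> set L" "t \<in> set L" for s t
  proof -
    have mem: "perm_of s \<in> GA" "perm_of t \<in> GA" using st L(2) A5_words_in_GA by auto
    obtain r where r: "r \<in> set A5_words" "word_comp r t = s" "word_fix r \<in> K"
      using assms(2) st unfolding quotients_in_def by blast
    have "perm_of r \<circ> perm_of t = perm_of s"
      using r(2) perm_of_comp[of t r] A5_words_are_words st L(2) by auto
    then have "perm_of s \<circ> inv' (perm_of t) = perm_of r" using GA_cancel(3)[OF mem(2)] by metis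
    then show ?thesis using intersect_iff[OF mem] bspec[OF assms(3) r(3)] by (simp add: nfix_perm_of)
  qed
  moreover have "perm_of ` set L \<subseteq> GA" using L(2) A5_words_in_GA by auto
  ultimately have "intersecting_set A5 \<Omega> \<phi> (perm_of ` set L)"
    by (auto simp: intersecting_set_def)
  moreover have "card (perm_of ` set L) = length L"
    using card_image[OF inj_on_subset[OF perm_of_inj L(2)]] distinct_card[OF L(1)] by simp
  ultimately show ?thesis using assms(1) unfolding maximum_intersecting_set_def by metis
qed

text \<open>The cases are distinguished by the nontrivial classes that have fixed points on \<open>\<Omega>\<close>: involutions,
three-cycles, five-cycles correspond to \<open>a\<close>, \<open>b\<close>, \<open>c\<close> being positive.\<close>

lemma maximum_in_canonical_span:
  assumes max: "maximum_intersecting_set A5 \<Omega> \<phi> S"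
  shows "char_vec S \<in> canonical_span"
proof -
  have inter: "intersecting_set A5 \<Omega> \<phi> S" and SG: "S \<subseteq> GA"
    using max by (auto simp: maximum_intersecting_set_def intersecting_set_def)
  let ?f = "\<lambda>x. of_bool (x \<in> S) :: real"
  define n a b c where fix_defs: "n = perm_char 5" "a = perm_char 1" "b = perm_char 2" "c = perm_char 0"
  have n: "n > 0" and count: "n + 15 * a + 20 * b + 24 * c = 60"
    using perm_char_5_pos orbit_counting by (simp_all add: fix_defs)
  define s i t v where pair_defs: "s = real (card S)" "i = class_pairs S 1" "t = class_pairs S 2" "v = class_pairs S 0"
  have total: "s + i + t + v = s * s"
    using class_pairs_sum[OF SG] by (simp add: pair_defs class_pairs_5 power2_eq_square)
  have derangements: "a = 0 \<Longrightarrow> i = 0" "b = 0 \<Longrightarrow> t = 0" "c = 0 \<Longrightarrow> v = 0"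
    using class_pairs_eq_0[OF inter] by (simp_all add: pair_defs fix_defs)
  have form_values:
    "(\<Sum>k\<in>{5, 1, 2, 0}. of_int (char_val 3 k) * class_pairs S k) = 6 * s - 2 * i + v"
    "(\<Sum>k\<in>{5, 1, 2, 0}. of_int (char_val 4 k) * class_pairs S k) = 4 * s + t - v"
    "(\<Sum>k\<in>{5, 1, 2, 0}. of_int (char_val 5 k) * class_pairs S k) = 5 * s + i - t"
    by (simp_all add: char_val_def pair_defs class_pairs_5)
  have "0 \<le> (\<Sum>k\<in>{5, 1, 2, 0}. of_int (char_val d k) * class_pairs S k)" if "d \<in> {3, 4, 5}" for d
    using isotypic_form_nonneg[OF that, of ?f] unfolding isotypic_form_class_pairs[OF SG] .
  from this[of 3] this[of 4] this[of 5]
  have forms: "6 * s - 2 * i + v \<ge> 0" "4 * s + t - v \<ge> 0" "5 * s + i - t \<ge> 0"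
    unfolding form_values by simp_all
  have criterion: "char_vec S \<in> canonical_span"
    if "n + 4 * c \<noteq> 5 * a \<or> 6 * s - 2 * i + v = 0"
      "n + 5 * b \<noteq> 6 * c \<or> 4 * s + t - v = 0"
      "n + 3 * a \<noteq> 4 * b \<or> 5 * s + i - t = 0"
    unfolding char_vec_eq[OF SG]
  proof (rule fun_vec_in_canonical_span)
    fix d :: nat assume d: "d \<in> {3, 4, 5}"
    have eigenvalues:
      "(\<Sum>k\<in>{5, 1, 2, 0}. int (perm_char k) * central_val 3 k) = int (n + 4 * c) - int (5 * a)"
      "(\<Sum>k\<in>{5, 1, 2, 0}. int (perm_char k) * central_val 4 k) = int (n + 5 * b) - int (6 * c)"
      "(\<Sum>k\<in>{5, 1, 2, 0}. int (perm_char k) * central_val 5 k) = int (n + 3 * a) - int (4 * b)"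
      by (simp_all add: central_val_def class_size_def char_val_def fix_defs)
    have "(\<Sum>k\<in>{5, 1, 2, 0}. int (perm_char k) * central_val d k) \<noteq> 0 \<or>
      (\<Sum>k\<in>{5, 1, 2, 0}. of_int (char_val d k) * class_pairs S k) = 0"
    proof -
      consider "d = 3" | "d = 4" | "d = 5" using d by blast
      then show ?thesis
      proof cases
        case 1
        then show ?thesis unfolding 1 eigenvalues right_minus_eq of_nat_eq_iff
          using that(1) by (simp add: form_values[simplified])
      next
        case 2
        then show ?thesis unfolding 2 eigenvalues right_minus_eq of_nat_eq_iff
          using that(2) by (simp add: form_values[simplified])
      next
        case 3
        then show ?thesis unfolding 3 eigenvalues right_minus_eq of_nat_eq_iff
          using that(3) by (simp add: form_values[simplified])
      qed
    qed
    then show "(\<Sum>k\<in>{5, 1, 2, 0}. int (perm_char k) * central_val d k) \<noteq> 0 \<or>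
      (\<forall>g\<in>GA. isotypic d ?f g = 0)"
      unfolding isotypic_form_class_pairs[OF SG, symmetric]
      by (rule disj_forward) (assumption, intro ballI isotypic_eq_0[OF d])
  qed
  have bound: "real (length L) \<le> s" if "quotients_in L K" "\<forall>k\<in>K. perm_char k > 0" for L K
    using maximum_ge_words[OF max that] by (simp add: pair_defs)
  consider "a = 0" "b = 0" "c = 0" | "a = 0" "b = 0" "c > 0" | "a = 0" "b > 0"
    | "a > 0" "b = 0" "c = 0" | "a > 0" "b > 0" "c = 0" | "a > 0" "b = 0" "c > 0"
    | "a > 0" "b > 0" "c > 0"
    by (cases "a = 0"; cases "b = 0"; cases "c = 0"; simp)
  then show ?thesis
  proof cases
    case 1
    then show ?thesis using n by (intro criterion) simp_all
  next
    case 2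
    \<comment> \<open>five-cycles only: all eigenvalues but that of \<open>\<chi>\<^sub>4\<close> are positive\<close>
    have "5 \<le> s" using bound[OF quotients_in_subgroups(2)] 2 n by (simp add: fix_defs subgroup_lengths)
    have "0 \<le> s * (5 - s)" using forms(2) total derangements 2 by (simp add: algebra_simps)
    with \<open>5 \<le> s\<close> have "s = 5" by (simp add: zero_le_mult_iff)
    then show ?thesis using 2 n total derangements by (intro criterion) simp_all
  next
    case 3
    \<comment> \<open>three-cycles but no involutions: \<open>n = 4b\<close> would give \<open>24 (b + c) = 60\<close>, and \<open>n + 5b = 6c\<close>
      would give \<open>5n + 40b = 60\<close>, whose only positive solution \<open>n = 4\<close>, \<open>b = 1\<close> makes \<open>6c = 9\<close>\<close>
    have "n \<noteq> 4 * b"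
    proof
      assume "n = 4 * b"
      then show False using count 3 by presburger
    qed
    moreover have "n + 5 * b \<noteq> 6 * c"
    proof
      assume c: "n + 5 * b = 6 * c"
      then have nb: "n + 8 * b = 12" using count 3 by linarith
      then have "b = 1" using 3 n by linarith
      then have "6 * c = 9" using nb c by linarith
      then show False by presburger
    qed
    ultimately show ?thesis using 3 n by (intro criterion) simp_all
  next
    case 4
    \<comment> \<open>involutions only: the form of \<open>\<rho>\<close> is \<open>2s (4 - s)\<close>\<close>
    have "4 \<le> s" using bound[OF quotients_in_subgroups(1)] 4 n by (simp add: fix_defs subgroup_lengths)
    have "0 \<le> s * (4 - s)" using forms(1) total derangements 4 by (simp add: algebra_simps)
    with \<open>4 \<le> s\<close> have "s = 4" by (simp add: zero_le_mult_iff)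
    then show ?thesis using 4 n total derangements by (intro criterion) simp_all
  next
    case 5
    \<comment> \<open>involutions and three-cycles: the forms of \<open>\<rho>\<close> and \<open>\<chi>\<^sub>5\<close> add up to
      \<open>11s - (i + t) = s (12 - s)\<close>\<close>
    have "12 \<le> s" using bound[OF quotients_in_subgroups(3)] 5 n by (auto simp: fix_defs subgroup_lengths)
    have "0 \<le> s * (12 - s)" using forms total derangements 5 by (simp add: algebra_simps)
    with \<open>12 \<le> s\<close> have "s = 12" by (simp add: zero_le_mult_iff)
    then show ?thesis using 5 n total derangements forms by (intro criterion) auto
  next
    case 6
    \<comment> \<open>involutions and five-cycles: half the form of \<open>\<rho>\<close> and \<open>3/2\<close> times that of \<open>\<chi>\<^sub>4\<close> add up
      to \<open>9s - (i + v) = s (10 - s)\<close>\<close>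
    have "10 \<le> s" using bound[OF quotients_in_subgroups(4)] 6 n by (auto simp: fix_defs subgroup_lengths)
    have "0 \<le> s * (10 - s)" using forms total derangements 6 by (simp add: algebra_simps)
    with \<open>10 \<le> s\<close> have "s = 10" by (simp add: zero_le_mult_iff)
    then show ?thesis using 6 n total derangements forms by (intro criterion) auto
  next
    case 7
    then have "perm_char (nfix x) > 0" if "x \<in> GA" for x
      using nfix_values[OF that] n by (auto simp: fix_defs)
    then have "intersecting_set A5 \<Omega> \<phi> GA"
      by (simp add: intersecting_set_def intersect_iff GA_comp GA_inv)
    then have "card GA \<le> card S" using max by (simp add: maximum_intersecting_set_def)
    then have "S = GA" using SG finite_GA by (intro card_seteq) auto
    then have "char_vec S = fun_vec (\<lambda>g. 1)" unfolding char_vec_eq[OF SG] by (intro fun_vec_cong) simp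
    then show ?thesis using const_in_canonical_span by simp
  qed
qed

end

section \<open>Every transitive action\<close>

theorem lemma6p2:
  shows "group_EKR_module_property TYPE('b) (alt_group 5)"
  unfolding group_EKR_module_property_def
proof (intro conjI allI impI)
  show "group A5" by (rule alt_group_is_group)
  show "finite GA" by (rule finite_GA)
  fix \<Omega> :: "'b set" and \<phi>
  assume act: "transitive_action A5 \<Omega> \<phi>"
  show "action_EKR_module_property A5 \<Omega> \<phi>"
  proof (cases "\<Omega> = {}")
    case True
    have empty: "S = {}" if "intersecting_set A5 \<Omega> \<phi> S" for S
      using that True by (auto simp: intersecting_set_def intersect_def)
    show ?thesis unfolding action_EKR_module_property_def
    proof (intro allI impI)
      fix S assume "maximum_intersecting_set A5 \<Omega> \<phi> S"
      then have "char_vec S = 0" using empty[of S] by (simp add: maximum_intersecting_set_def char_vec_def)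
      then show "char_vec S \<in> group_algebra.span
        {canonical_vec A5 \<phi> \<alpha> \<beta> | \<alpha> \<beta>. \<alpha> \<in> \<Omega> \<and> \<beta> \<in> \<Omega>}"
        by (simp only: group_algebra.span_zero)
    qed
  next
    case False
    then interpret A5_action \<Omega> \<phi> by (intro A5_action.intro act A5_action_axioms.intro)
    show ?thesis unfolding action_EKR_module_property_def using maximum_in_canonical_span by blast
  qed
qed

end
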